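(* Let $\alpha>0$. There is a constant $C$ depending only on $\alpha$, and one may take $C=\frac{2}{\alpha}\Gamma\left(\frac{1}{\alpha}\right)(\alpha e)^{\frac{1}{\alpha}}$, such that the following holds. Let $0<q<r\leq\infty$, let $b\in\mathbb{R}$, and let $f:\mathbb{R}\rightarrow\mathbb{R}$ be a measurable function with $0<\|f\|_q<\infty$, $\|f\|_r<\infty$ and finite $\alpha$-th order $q$-moment $\mu_{q,\alpha}$ about $b$. Then $$\|f\|_q\leq \left(C\,\mu_{q,\alpha}^{\frac{1}{\alpha}}\right)^{\frac{1}{q}-\frac{1}{r}}\|f\|_r.$$
   Context: All integrals are with respect to Lebesgue measure. For $0<p<\infty$, $\|f\|_p=\left(\int_{\mathbb{R}}|f(x)|^p\,dx\right)^{1/p}$, and $\|f\|_\infty=\operatorname{ess\,sup}_{x\in\mathbb{R}}|f(x)|$; when $r=\infty$, $\frac1r$ is read as $0$. For a measurable $f$ with $0<\|f\|_q<\infty$, the $\alpha$-th order $q$-moment about $b$ is $$\mu_{q,\alpha}=\frac{\int_{\mathbb{R}}|x-b|^\alpha|f(x)|^q\,dx}{\int_{\mathbb{R}}|f(x)|^q\,dx}.$$ $\Gamma$ is the Gamma function. *)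

theory Defs
  imports "HOL-Probability.Essential_Supremum"
begin

text \<open>
  Norms and moments take values in the extended nonnegative reals, so that their finiteness is a
  meaningful hypothesis. The power below has the intended meaning for positive exponents only.
\<close>

definition ennreal_powr :: "ennreal \<Rightarrow> real \<Rightarrow> ennreal" where
  "ennreal_powr x a = (if x = \<infinity> then \<infinity> else ennreal (enn2real x powr a))"

text \<open>Intended for exponents \<open>0 < p \<le> \<infinity>\<close>; for \<open>p < 1\<close> this is not a norm.\<close>

definition Lp_norm :: "ereal \<Rightarrow> (real \<Rightarrow> real) \<Rightarrow> ennreal" where
  "Lp_norm p f =
     (if p = \<infinity> then esssup lebesgue (\<lambda>x. ennreal \<bar>f x\<bar>)
      else ennreal_powr (\<integral>\<^sup>+ x. ennreal (\<bar>f x\<bar> powr real_of_ereal p) \<partial>lebesgue) (1 / real_of_ereal p))"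

definition q_moment :: "real \<Rightarrow> real \<Rightarrow> real \<Rightarrow> (real \<Rightarrow> real) \<Rightarrow> ennreal" where
  "q_moment q \<alpha> b f =
     (\<integral>\<^sup>+ x. ennreal (\<bar>x - b\<bar> powr \<alpha> * \<bar>f x\<bar> powr q) \<partial>lebesgue) /
     (\<integral>\<^sup>+ x. ennreal (\<bar>f x\<bar> powr q) \<partial>lebesgue)"

definition moment_const :: "real \<Rightarrow> real" where
  "moment_const \<alpha> = 2 / \<alpha> * Gamma (1 / \<alpha>) * (\<alpha> * exp 1) powr (1 / \<alpha>)"

end

theory Submission
  imports Defs
begin

text \<open>
  Normalise \<open>g = \<bar>f\<bar>\<^sup>q / \<integral>\<bar>f\<bar>\<^sup>q\<close>, a probability density with moment \<open>m\<close>, and compare it with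
  \<open>w = exp (- c \<bar>x - b\<bar>\<^sup>\<alpha>)\<close> for \<open>c = 1 / (\<alpha> m)\<close>, the shape of the maximiser of entropy under the moment constraint.
  With \<open>Z = \<integral>w\<close> and \<open>M = Z e\<^sup>1\<^sup>/\<^sup>\<alpha>\<close>, which is the constant of the theorem times \<open>m\<^sup>1\<^sup>/\<^sup>\<alpha>\<close>, the inequality
  \<open>ln u \<le> u - 1\<close> at \<open>u = w / (Z g)\<close> bounds \<open>g ln (M g)\<close> from below by a function with integral \<open>0\<close>.
  The entropy is thus bounded without having to be integrable. For finite \<open>r\<close> the tangent inequality
  \<open>(M g)\<^sup>p\<^sup>-\<^sup>1 \<ge> 1 + (p - 1) ln (M g)\<close> with \<open>p = r / q\<close>, multiplied by \<open>g\<close> and integrated, gives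
  \<open>\<integral>g\<^sup>p \<ge> M\<^sup>1\<^sup>-\<^sup>p\<close>; for \<open>r = \<infinity>\<close> a bound \<open>g \<le> G\<close> gives \<open>0 \<le> ln (M G)\<close>.
\<close>

section \<open>The integral of exp (- c \<bar>x - b\<bar> powr \<alpha>)\<close>

lemma has_integral_exp_powr_halfline:
  fixes \<alpha> c :: real
  assumes "\<alpha> > 0" "c > 0"
  shows "((\<lambda>x. exp (- c * x powr \<alpha>)) has_integral (1 / \<alpha> * Gamma (1 / \<alpha>) * c powr (- 1 / \<alpha>))) {0<..}"
proof -
  \<comment> \<open>The substitution t = \<open>?g x\<close> in the Gamma integral of
    \<open>?f\<close> yields the claim up to the factor \<alpha> * c powr (1 / \<alpha>).\<close>
  let ?f = "\<lambda>t::real. t powr (1 / \<alpha> - 1) / exp t"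
  let ?g = "\<lambda>x::real. c * x powr \<alpha>"
  let ?g' = "\<lambda>x::real. c * (\<alpha> * x powr (\<alpha> - 1))"
  have "(?f has_integral Gamma (1 / \<alpha>)) {0..}"
    by (rule Gamma_integral_real) (use assms in auto)
  \<comment> \<open>On the open half-line \<open>?g\<close> is a differentiable bijection onto the
    same set; at 0 its derivative blows up if \<alpha> < 1.\<close>
  then have f: "(?f has_integral Gamma (1 / \<alpha>)) {0<..}"
  proof (subst has_integral_spike_set_eq[where T = "{0..}"])
    show "negligible {x \<in> {0..} - {0<..}. ?f x \<noteq> 0}"
      by (rule negligible_subset[of "{0}"]) auto
    show "negligible {x \<in> {0<..} - {0..}. ?f x \<noteq> 0}"
      by (rule negligible_subset[of "{}"]) auto
  qed
  then have "?f absolutely_integrable_on {0<..}"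
    by (intro nonnegative_absolutely_integrable_1 has_integral_integrable) auto
  moreover have "?g ` {0<..} = {0<..}"
  proof (intro equalityI subsetI)
    fix y :: real assume "y \<in> {0<..}"
    then have "y = ?g ((y / c) powr (1 / \<alpha>))" "(y / c) powr (1 / \<alpha>) > 0"
      using assms by (auto simp: powr_powr)
    then show "y \<in> ?g ` {0<..}" by blast
  qed (use assms in auto)
  moreover have "inj_on ?g {0<..}"
    using assms by (intro inj_on_inverseI[where g = "\<lambda>y. (y / c) powr (1 / \<alpha>)"]) (auto simp: powr_powr)
  moreover have "(?g has_field_derivative ?g' x) (at x within {0<..})" if "x \<in> {0<..}" for x
    using that by (auto intro!: derivative_eq_intros)
  ultimately have *: "(\<lambda>x. \<bar>?g' x\<bar> * ?f (?g x)) absolutely_integrable_on {0<..} \<and>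
      integral {0<..} (\<lambda>x. \<bar>?g' x\<bar> * ?f (?g x)) = Gamma (1 / \<alpha>)"
    using f integral_unique
    by (subst has_absolute_integral_change_of_variables_1'[where g = ?g]) auto
  have "((\<lambda>x. \<bar>?g' x\<bar> * ?f (?g x)) has_integral Gamma (1 / \<alpha>)) {0<..}"
    using integrable_integral[OF set_lebesgue_integral_eq_integral(1)[OF conjunct1[OF *]]]
    unfolding conjunct2[OF *] .
  moreover have "\<bar>?g' x\<bar> * ?f (?g x) = \<alpha> * c powr (1 / \<alpha>) * exp (- c * x powr \<alpha>)"
    if "x \<in> {0<..}" for x
  proof -
    have "\<bar>?g' x\<bar> * ?f (?g x) = ?g' x * (c powr (1 / \<alpha>) / c * x powr (1 - \<alpha>)) / exp (?g x)"
      using assms that by (simp add: powr_mult powr_diff powr_powr right_diff_distrib)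
    also have "\<dots> = \<alpha> * c powr (1 / \<alpha>) * (x powr (\<alpha> - 1) * x powr (1 - \<alpha>)) * exp (- ?g x)"
      using assms by (simp add: exp_minus divide_simps)
    also have "x powr (\<alpha> - 1) * x powr (1 - \<alpha>) = 1"
      using that by (simp flip: powr_add)
    finally show ?thesis by simp
  qed
  ultimately have "((\<lambda>x. \<alpha> * c powr (1 / \<alpha>) * exp (- c * x powr \<alpha>)) has_integral Gamma (1 / \<alpha>)) {0<..}"
    by (rule has_integral_eq[rotated])
  from has_integral_mult_right[OF this, of "inverse (\<alpha> * c powr (1 / \<alpha>))"]
  show ?thesis
    using assms by (simp add: powr_minus field_simps)
qed

lemma has_bochner_integral_exp_powr_abs:
  fixes \<alpha> b c :: real
  assumes "\<alpha> > 0" "c > 0"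
  shows "has_bochner_integral lebesgue (\<lambda>x. exp (- c * \<bar>x - b\<bar> powr \<alpha>))
    (2 / \<alpha> * Gamma (1 / \<alpha>) * c powr (- 1 / \<alpha>))"
proof (rule has_bochner_integral_nn_integral)
  let ?I = "1 / \<alpha> * Gamma (1 / \<alpha>) * c powr (- 1 / \<alpha>)"
  let ?h = "\<lambda>x. exp (- c * \<bar>x\<bar> powr \<alpha>)"
  have I: "?I \<ge> 0"
    using assms by (simp add: Gamma_real_nonneg)
  have "(\<integral>\<^sup>+x. ennreal (indicator {0<..} x * exp (- c * x powr \<alpha>)) \<partial>lborel) = ?I"
    by (rule nn_integral_has_integral_lebesgue) (use has_integral_exp_powr_halfline[OF assms] in auto)
  also have "(\<integral>\<^sup>+x. ennreal (indicator {0<..} x * exp (- c * x powr \<alpha>)) \<partial>lborel) =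
      (\<integral>\<^sup>+x. ennreal (indicator {0<..} x * ?h x) \<partial>lborel)"
    by (intro nn_integral_cong) (auto simp: indicator_def)
  finally have pos: "(\<integral>\<^sup>+x. ennreal (indicator {0<..} x * ?h x) \<partial>lborel) = ?I" .
  \<comment> \<open>The reflection x \<mapsto> -x exchanges the half-lines and fixes the even
    function \<open>?h\<close>.\<close>
  also have "(\<integral>\<^sup>+x. ennreal (indicator {0<..} x * ?h x) \<partial>lborel) =
      (\<integral>\<^sup>+x. ennreal (indicator {..<0} x * ?h x) \<partial>lborel)"
    by (subst nn_integral_real_affine[of _ "-1" 0]) (auto simp: indicator_def intro!: nn_integral_cong)
  finally have neg: "(\<integral>\<^sup>+x. ennreal (indicator {..<0} x * ?h x) \<partial>lborel) = ?I" .
  have "(\<integral>\<^sup>+x. ennreal (?h (x - b)) \<partial>lebesgue) = (\<integral>\<^sup>+x. ennreal (?h (x - b)) \<partial>lborel)"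
    by (rule nn_integral_completion)
  also have "\<dots> = (\<integral>\<^sup>+x. ennreal (?h x) \<partial>lborel)"
    by (subst nn_integral_real_affine[of _ 1 b]) auto
  \<comment> \<open>The point 0 belongs to neither half-line, so the splitting holds almost
    everywhere only.\<close>
  also have "\<dots> = (\<integral>\<^sup>+x. ennreal (indicator {0<..} x * ?h x) + ennreal (indicator {..<0} x * ?h x) \<partial>lborel)"
    by (intro nn_integral_cong_AE eventually_mono[OF AE_lborel_singleton[of "0::real"]])
       (auto simp: indicator_def)
  also have "\<dots> = ennreal ?I + ennreal ?I"
    unfolding pos[symmetric] by (subst nn_integral_add) (simp_all only: pos neg, auto)
  also have "\<dots> = ennreal (2 / \<alpha> * Gamma (1 / \<alpha>) * c powr (- 1 / \<alpha>))"
    using I by (simp flip: ennreal_plus)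
  finally show "(\<integral>\<^sup>+x. ennreal (exp (- c * \<bar>x - b\<bar> powr \<alpha>)) \<partial>lebesgue) =
      ennreal (2 / \<alpha> * Gamma (1 / \<alpha>) * c powr (- 1 / \<alpha>))" .
  show "(\<lambda>x. exp (- c * \<bar>x - b\<bar> powr \<alpha>)) \<in> borel_measurable lebesgue"
    by (rule measurable_completion) simp
qed (use assms in \<open>auto simp: Gamma_real_nonneg\<close>)

section \<open>The entropy bound and its consequences for densities\<close>

lemma moment_const_pos: "\<alpha> > 0 \<Longrightarrow> moment_const \<alpha> > 0"
  by (simp add: moment_const_def Gamma_real_pos)

text \<open>This is Gibbs' inequality for \<open>g\<close> against the density w / Z, kept
  pointwise. The minorant \<open>k\<close> is a linear combination of integrable functions, so later
  integrations use \<open>k\<close> in place of the logarithm.\<close>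

lemma entropy_minorant:
  fixes \<alpha> b m :: real and g :: "real \<Rightarrow> real"
  defines "M \<equiv> moment_const \<alpha> * m powr (1 / \<alpha>)"
  assumes "\<alpha> > 0" "m > 0"
    and nonneg: "\<And>x. g x \<ge> 0"
    and g: "has_bochner_integral lebesgue g 1"
    and gm: "has_bochner_integral lebesgue (\<lambda>x. \<bar>x - b\<bar> powr \<alpha> * g x) m"
  obtains k where "has_bochner_integral lebesgue k 0" "\<And>x. k x \<le> g x * ln (M * g x)"
proof
  \<comment> \<open>This value minimises ln Z + c * m, the Gibbs bound on the entropy of
    \<open>g\<close>. It gives c * m = 1 / \<alpha>, which is why the integral of \<open>k\<close>
    vanishes and where the factor exp (1 / \<alpha>) in \<open>M\<close> originates.\<close>
  define c where "c = 1 / (\<alpha> * m)"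
  define w where "w x = exp (- c * \<bar>x - b\<bar> powr \<alpha>)" for x
  define Z where "Z = 2 / \<alpha> * Gamma (1 / \<alpha>) * c powr (- 1 / \<alpha>)"
  define k where "k x = (1 + 1 / \<alpha>) * g x - c * (\<bar>x - b\<bar> powr \<alpha> * g x) - w x / Z" for x
  have c: "c > 0" and Z: "Z > 0"
    using assms by (auto simp: c_def Z_def Gamma_real_pos)
  have w: "has_bochner_integral lebesgue w Z"
    unfolding w_def Z_def by (rule has_bochner_integral_exp_powr_abs) fact+
  have M: "M = Z * exp (1 / \<alpha>)"
    using assms unfolding M_def Z_def c_def moment_const_def
    by (simp add: powr_divide powr_mult powr_minus exp_powr_real field_simps)
  have "has_bochner_integral lebesgue k ((1 + 1 / \<alpha>) * 1 - c * m - Z / Z)"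
    unfolding k_def
    by (intro has_bochner_integral_diff has_bochner_integral_mult_right has_bochner_integral_divide_zero g gm w)
  also have "(1 + 1 / \<alpha>) * 1 - c * m - Z / Z = 0"
    using assms Z by (simp add: c_def)
  finally show "has_bochner_integral lebesgue k 0" .
  show "k x \<le> g x * ln (M * g x)" for x
  proof (cases "g x = 0")
    case True
    \<comment> \<open>Here \<open>k x\<close> is - w x / Z < 0, while the right-hand side is
      0.\<close>
    then show ?thesis using Z by (simp add: k_def w_def)
  next
    case False
    with nonneg[of x] have gx: "g x > 0" by simp
    have "ln (w x / (Z * g x)) \<le> w x / (Z * g x) - 1"
      using Z gx by (intro ln_le_minus_one) (simp add: w_def)
    moreover have "ln (w x / (Z * g x)) = 1 / \<alpha> - c * \<bar>x - b\<bar> powr \<alpha> - ln (M * g x)"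
      using Z gx by (simp add: w_def ln_div ln_mult M)
    ultimately have "1 + 1 / \<alpha> - c * \<bar>x - b\<bar> powr \<alpha> - w x / (Z * g x) \<le> ln (M * g x)"
      by simp
    then have "g x * (1 + 1 / \<alpha> - c * \<bar>x - b\<bar> powr \<alpha> - w x / (Z * g x)) \<le> g x * ln (M * g x)"
      using gx by (intro mult_left_mono) auto
    moreover have "g x * (1 + 1 / \<alpha> - c * \<bar>x - b\<bar> powr \<alpha> - w x / (Z * g x)) = k x"
      using gx Z by (simp add: k_def field_simps)
    ultimately show ?thesis by simp
  qed
qed

text \<open>Convexity of exp turns the logarithmic bound into a bound on powers; as \<open>k\<close>
  has integral 0, only the total mass 1 of \<open>g\<close> survives on the left.\<close>

lemma density_powr_integral_ge:
  fixes \<alpha> b m p :: real and g :: "real \<Rightarrow> real"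
  defines "M \<equiv> moment_const \<alpha> * m powr (1 / \<alpha>)"
  assumes "\<alpha> > 0" "m > 0" "p > 1"
    and nonneg: "\<And>x. g x \<ge> 0"
    and g: "has_bochner_integral lebesgue g 1"
    and gm: "has_bochner_integral lebesgue (\<lambda>x. \<bar>x - b\<bar> powr \<alpha> * g x) m"
    and gp: "has_bochner_integral lebesgue (\<lambda>x. g x powr p) R"
  shows "M powr (1 - p) \<le> R"
proof -
  obtain k where k: "has_bochner_integral lebesgue k 0" "\<And>x. k x \<le> g x * ln (M * g x)"
    using entropy_minorant[OF assms(2,3) nonneg g gm] unfolding M_def by blast
  have M: "M > 0"
    using assms by (simp add: M_def moment_const_pos)
  have "g x + (p - 1) * k x \<le> M powr (p - 1) * g x powr p" for x
  proof (cases "g x = 0")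
    case True
    then show ?thesis using k(2)[of x] \<open>p > 1\<close> by (simp add: mult_nonneg_nonpos)
  next
    case False
    with nonneg[of x] have gx: "g x > 0" by simp
    have "g x + (p - 1) * k x \<le> g x + (p - 1) * (g x * ln (M * g x))"
      using k(2)[of x] \<open>p > 1\<close> by (intro add_left_mono mult_left_mono) auto
    also have "\<dots> = g x * (1 + (p - 1) * ln (M * g x))"
      by (simp add: algebra_simps)
    \<comment> \<open>The inequality 1 + t \<le> exp t at t = (p - 1) * ln (M * g x).\<close>
    also have "\<dots> \<le> g x * exp ((p - 1) * ln (M * g x))"
      using gx by (intro mult_left_mono exp_ge_add_one_self) auto
    also have "exp ((p - 1) * ln (M * g x)) = M powr (p - 1) * (g x powr p / g x)"
      using M gx powr_def[of "M * g x" "p - 1"] by (simp add: powr_mult powr_diff)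
    finally show ?thesis using gx by simp
  qed
  then have "1 + (p - 1) * 0 \<le> M powr (p - 1) * R"
    using has_bochner_integral_add[OF g has_bochner_integral_mult_right[OF k(1)]]
      has_bochner_integral_mult_right[OF gp]
    by (metis (no_types, lifting) has_bochner_integral_iff integral_mono)
  moreover have "M powr (1 - p) = 1 / M powr (p - 1)"
    by (metis minus_diff_eq powr_minus_divide)
  ultimately show ?thesis
    using M by (simp add: divide_le_eq mult.commute)
qed

text \<open>Monotonicity of ln replaces the tangent inequality: \<open>k\<close> lies almost
  everywhere below g * ln (M * G), whose integral is ln (M * G), so M * G \<ge> 1.\<close>

lemma density_sup_ge:
  fixes \<alpha> b m G :: real and g :: "real \<Rightarrow> real"
  defines "M \<equiv> moment_const \<alpha> * m powr (1 / \<alpha>)"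
  assumes "\<alpha> > 0" "m > 0" "G > 0"
    and nonneg: "\<And>x. g x \<ge> 0"
    and g: "has_bochner_integral lebesgue g 1"
    and gm: "has_bochner_integral lebesgue (\<lambda>x. \<bar>x - b\<bar> powr \<alpha> * g x) m"
    and gG: "AE x in lebesgue. g x \<le> G"
  shows "1 / M \<le> G"
proof -
  obtain k where k: "has_bochner_integral lebesgue k 0" "\<And>x. k x \<le> g x * ln (M * g x)"
    using entropy_minorant[OF assms(2,3) nonneg g gm] unfolding M_def by blast
  have M: "M > 0"
    using assms by (simp add: M_def moment_const_pos)
  have "k x \<le> g x * ln (M * G)" if "g x \<le> G" for x
  proof (cases "g x = 0")
    case False
    with nonneg[of x] have "g x > 0" by simp
    then have "g x * ln (M * g x) \<le> g x * ln (M * G)"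
      using M that \<open>G > 0\<close> by (intro mult_left_mono ln_mono) auto
    with k(2)[of x] show ?thesis by simp
  qed (use k(2)[of x] in simp)
  with gG have "AE x in lebesgue. k x \<le> g x * ln (M * G)"
    by (auto elim: eventually_mono)
  then have "0 \<le> 1 * ln (M * G)"
    using k(1) has_bochner_integral_mult_left[OF g]
    by (metis has_bochner_integral_iff integral_mono_AE)
  then show ?thesis
    using M \<open>G > 0\<close> by (simp add: divide_le_eq mult.commute)
qed

section \<open>Normalising \<open>f\<close> and undoing the normalisation\<close>

lemma ennreal_powr_ennreal: "x \<ge> 0 \<Longrightarrow> ennreal_powr (ennreal x) a = ennreal (x powr a)"
  by (simp add: ennreal_powr_def)

theorem theorem1:
  fixes \<alpha> q b :: real and r :: ereal and f :: "real \<Rightarrow> real"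
  assumes "\<alpha> > 0"
    and "0 < q" and "ereal q < r"
    and "f \<in> borel_measurable lebesgue"
    and "0 < Lp_norm (ereal q) f" and "Lp_norm (ereal q) f < \<infinity>"
    and "Lp_norm r f < \<infinity>"
    and "q_moment q \<alpha> b f < \<infinity>"
  shows "Lp_norm (ereal q) f \<le>
    ennreal_powr (ennreal (moment_const \<alpha>) * ennreal_powr (q_moment q \<alpha> b f) (1 / \<alpha>))
      (1 / q - real_of_ereal (1 / r)) * Lp_norm r f"
proof -
  note [measurable] = assms(4)
  have meas[measurable]: "(\<lambda>x. x) \<in> lebesgue \<rightarrow>\<^sub>M borel"
    by (simp add: measurable_completion)
  define A where "A = enn2real (\<integral>\<^sup>+ x. ennreal (\<bar>f x\<bar> powr q) \<partial>lebesgue)"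
  define B where "B = enn2real (\<integral>\<^sup>+ x. ennreal (\<bar>x - b\<bar> powr \<alpha> * \<bar>f x\<bar> powr q) \<partial>lebesgue)"
  \<comment> \<open>\<open>ennreal_powr\<close> sends \<infinity> to \<infinity>, so a finite norm
    forces a finite integral.\<close>
  have A_eq: "(\<integral>\<^sup>+ x. ennreal (\<bar>f x\<bar> powr q) \<partial>lebesgue) = ennreal A"
    using assms(6) by (auto simp: A_def Lp_norm_def ennreal_powr_def less_top split: if_splits)
  have "A \<ge> 0" by (simp add: A_def)
  then have norm_q: "Lp_norm (ereal q) f = ennreal (A powr (1 / q))"
    by (simp add: Lp_norm_def A_eq ennreal_powr_ennreal)
  with assms(5) have A: "A > 0"
    using \<open>A \<ge> 0\<close> by (cases "A = 0") auto
  have "(\<integral>\<^sup>+ x. ennreal (\<bar>x - b\<bar> powr \<alpha> * \<bar>f x\<bar> powr q) \<partial>lebesgue) \<noteq> \<infinity>"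
    using assms(8) A by (auto simp: q_moment_def A_eq ennreal_top_divide)
  then have B_eq: "(\<integral>\<^sup>+ x. ennreal (\<bar>x - b\<bar> powr \<alpha> * \<bar>f x\<bar> powr q) \<partial>lebesgue) = ennreal B"
    by (simp add: B_def less_top)
  \<comment> \<open>A vanishing moment would make \<open>f\<close> zero almost everywhere off the
    null set {b}, against A > 0. Positivity of \<open>m\<close> rests on this.\<close>
  have B: "B > 0"
  proof (rule ccontr)
    assume "\<not> B > 0"
    then have "(\<integral>\<^sup>+ x. ennreal (\<bar>x - b\<bar> powr \<alpha> * \<bar>f x\<bar> powr q) \<partial>lebesgue) = 0"
      unfolding B_eq by (simp add: ennreal_eq_0_iff)
    then have "AE x in lebesgue. ennreal (\<bar>x - b\<bar> powr \<alpha> * \<bar>f x\<bar> powr q) = 0"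
      by (subst (asm) nn_integral_0_iff_AE) auto
    moreover have "AE x in lebesgue. x \<noteq> b"
      by (intro AE_completion AE_lborel_singleton)
    ultimately have "AE x in lebesgue. ennreal (\<bar>f x\<bar> powr q) = 0"
      by eventually_elim (auto simp: ennreal_eq_0_iff mult_le_0_iff)
    then have "(\<integral>\<^sup>+ x. ennreal (\<bar>f x\<bar> powr q) \<partial>lebesgue) = 0"
      by (subst nn_integral_0_iff_AE) auto
    with A show False by (simp add: A_eq)
  qed
  define m where "m = B / A"
  define M where "M = moment_const \<alpha> * m powr (1 / \<alpha>)"
  define g where "g x = \<bar>f x\<bar> powr q / A" for x
  have m: "m > 0" using A B by (simp add: m_def)
  have M: "M > 0" using m assms(1) by (simp add: M_def moment_const_pos)
  have "q_moment q \<alpha> b f = ennreal m"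
    unfolding q_moment_def A_eq B_eq m_def using A B by (simp add: divide_ennreal)
  then have mom: "ennreal (moment_const \<alpha>) * ennreal_powr (q_moment q \<alpha> b f) (1 / \<alpha>) = ennreal M"
    using m moment_const_pos[OF assms(1)] by (simp add: ennreal_powr_ennreal M_def ennreal_mult)
  have nonneg: "g x \<ge> 0" for x using A by (simp add: g_def)
  have "has_bochner_integral lebesgue (\<lambda>x. \<bar>f x\<bar> powr q) A"
    by (rule has_bochner_integral_nn_integral) (use A A_eq in simp_all)
  from has_bochner_integral_divide_zero[OF this, of A] have g: "has_bochner_integral lebesgue g 1"
    using A by (simp add: g_def[abs_def])
  have "has_bochner_integral lebesgue (\<lambda>x. \<bar>x - b\<bar> powr \<alpha> * \<bar>f x\<bar> powr q) B"
    by (rule has_bochner_integral_nn_integral) (use B B_eq in \<open>simp_all del: ennreal_mult'\<close>)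
  from has_bochner_integral_divide_zero[OF this, of A]
  have gm: "has_bochner_integral lebesgue (\<lambda>x. \<bar>x - b\<bar> powr \<alpha> * g x) m"
    by (simp add: g_def m_def)
  \<comment> \<open>Both cases reduce to an inequality between reals, with \<open>N\<close> the real
    value of the r-norm.\<close>
  have "\<exists>N\<ge>0. Lp_norm r f = ennreal N \<and> A powr (1 / q) \<le> M powr (1 / q - real_of_ereal (1 / r)) * N"
  proof (cases r)
    case (real s)
    define p where "p = s / q"
    have s: "s > q" "s > 0" and p: "p > 1"
      using assms(2,3) real by (auto simp: p_def)
    define R where "R = enn2real (\<integral>\<^sup>+ x. ennreal (\<bar>f x\<bar> powr s) \<partial>lebesgue)"
    have R_eq: "(\<integral>\<^sup>+ x. ennreal (\<bar>f x\<bar> powr s) \<partial>lebesgue) = ennreal R"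
      using assms(7) by (auto simp: real R_def Lp_norm_def ennreal_powr_def less_top split: if_splits)
    have R: "R \<ge> 0" by (simp add: R_def)
    have norm_r: "Lp_norm r f = ennreal (R powr (1 / s))"
      using R by (simp add: real Lp_norm_def R_eq ennreal_powr_ennreal)
    have "has_bochner_integral lebesgue (\<lambda>x. \<bar>f x\<bar> powr s) R"
      by (rule has_bochner_integral_nn_integral) (use R R_eq in simp_all)
    from has_bochner_integral_divide_zero[OF this, of "A powr p"]
    have "has_bochner_integral lebesgue (\<lambda>x. g x powr p) (R / A powr p)"
      using A assms(2) by (simp add: g_def powr_divide powr_powr p_def)
    from density_powr_integral_ge[OF assms(1) m p nonneg g gm this]
    have "A powr p * M powr (1 - p) \<le> R"
      using A by (simp add: M_def field_simps)
    \<comment> \<open>Taking s-th roots gives the right exponents: p / s = 1 / q and (1 - p) / s = 1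
      / s - 1 / q.\<close>
    then have "(A powr p * M powr (1 - p)) powr (1 / s) \<le> R powr (1 / s)"
      using s A M by (intro powr_mono2) auto
    also have "(A powr p * M powr (1 - p)) powr (1 / s) = A powr (1 / q) * M powr (1 / s - 1 / q)"
      using s assms(2) A M by (simp add: powr_mult powr_powr p_def diff_divide_distrib)
    finally have "M powr (1 / q - 1 / s) * (A powr (1 / q) * M powr (1 / s - 1 / q))
        \<le> M powr (1 / q - 1 / s) * R powr (1 / s)"
      by (intro mult_left_mono) auto
    also have "M powr (1 / q - 1 / s) * (A powr (1 / q) * M powr (1 / s - 1 / q)) = A powr (1 / q)"
      using M by (simp add: powr_diff field_simps)
    finally have "A powr (1 / q) \<le> M powr (1 / q - real_of_ereal (1 / r)) * R powr (1 / s)"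
      using s by (simp add: real one_ereal_def del: ereal_eq_1)
    then show ?thesis using norm_r by (intro exI[of _ "R powr (1 / s)"]) simp
  next
    case PInf
    define N where "N = enn2real (Lp_norm r f)"
    have norm_r: "Lp_norm r f = ennreal N"
      using assms(7) by (simp add: N_def less_top)
    have N0: "N \<ge> 0" by (simp add: N_def)
    have "AE x in lebesgue. ennreal \<bar>f x\<bar> \<le> Lp_norm r f"
      unfolding PInf Lp_norm_def by (simp add: esssup_AE)
    then have le: "AE x in lebesgue. \<bar>f x\<bar> \<le> N"
      using N0 by (simp add: norm_r)
    \<comment> \<open>If \<open>N\<close> were 0, \<open>f\<close> would vanish almost everywhere.
      With N > 0 the bound N powr q / A on \<open>g\<close> is positive, as
      \<open>density_sup_ge\<close> requires.\<close>
    have "N \<noteq> 0"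
    proof
      assume "N = 0"
      with le have "AE x in lebesgue. ennreal (\<bar>f x\<bar> powr q) = 0"
        by (auto elim: eventually_mono)
      then have "(\<integral>\<^sup>+ x. ennreal (\<bar>f x\<bar> powr q) \<partial>lebesgue) = 0"
        by (subst nn_integral_0_iff_AE) auto
      with A show False by (simp add: A_eq)
    qed
    with N0 have N: "N > 0" by simp
    have "AE x in lebesgue. g x \<le> N powr q / A"
      using le A assms(2)
      by (auto elim!: eventually_mono simp: g_def intro!: divide_right_mono powr_mono2)
    from density_sup_ge[OF assms(1) m _ nonneg g gm this]
    have "A \<le> M * N powr q"
      using A N M by (simp add: M_def field_simps)
    then have "A powr (1 / q) \<le> (M * N powr q) powr (1 / q)"
      using A assms(2) by (intro powr_mono2) auto
    also have "\<dots> = M powr (1 / q) * N"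
      using M N assms(2) by (simp add: powr_mult powr_powr)
    \<comment> \<open>For r = \<infinity> the term 1 / r evaluates to 0, leaving the exponent 1 /
      q.\<close>
    finally show ?thesis
      using norm_r N by (intro exI[of _ N]) (simp add: PInf)
  qed (use assms(3) in auto)
  then show ?thesis
    using M by (auto simp: norm_q mom ennreal_powr_ennreal simp flip: ennreal_mult)
qed

end
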